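(* Let $F:V\to\mathbb R$ be convex and $L_F$-smooth ($L_F>0$), and let $N:V\to V$ be monotone. Let $x^\star$ satisfy $\nabla F(x^\star)+N(x^\star)=0$. Given $x_0,y_0\in V$ and $\gamma_0>0$, let $(x_k,y_k,\gamma_k)$ be generated, with $\alpha_k=\sqrt{\gamma_k/L_F}$, by $$\frac{\tilde x_{k+1}-x_k}{\alpha_k}=y_k-\tilde x_{k+1},\qquad \frac{y_{k+1}-y_k}{\alpha_k}=-\frac1{\gamma_k}\big(\nabla F(\tilde x_{k+1})+N(y_{k+1})\big),$$ $$\frac{x_{k+1}-x_k}{\alpha_k}=y_{k+1}-x_{k+1},\qquad \frac{\gamma_{k+1}-\gamma_k}{\alpha_k}=-\gamma_{k+1}.$$ With $\mathcal E(x,y,\gamma)=D_F(x,x^\star)+\frac\gamma2\|y-x^\star\|^2$, one has for all $k\ge 0$ $$\mathcal E(x_{k+1},y_{k+1},\gamma_{k+1})\le\frac1{1+\alpha_k}\,\mathcal E(x_k,y_k,\gamma_k).$$ Consequently, for any $\gamma_0>0$ and all $k\ge0$, $$\mathcal E(x_k,y_k,\gamma_k)\le\frac{1}{(c_0k+1)^2}\,\mathcal E(x_0,y_0,\gamma_0),\qquad c_0=\frac{\sqrt{\gamma_0/L_F}}{\sqrt{\sqrt{\gamma_0/L_F}+1}+1}.$$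
   Context: $V$ is a real Hilbert space with inner product $(\cdot,\cdot)$ and norm $\|\cdot\|$, identified with its dual. $N$ is monotone if $(N(x)-N(y),x-y)\ge0$ for all $x,y$. $F$ is $L_F$-smooth if it is continuously differentiable with $L_F$-Lipschitz gradient. The Bregman divergence is $D_F(y,x)=F(y)-F(x)-\langle\nabla F(x),y-x\rangle$. *)

theory Defs
  imports "HOL-Analysis.Analysis"
begin

text \<open>
  The dual of the Hilbert space is identified with the space itself, so the gradient is
  the vector representing the Frechet derivative through the inner product, as in
  \<^const>\<open>gderiv\<close>. It is meaningful only where such a vector exists.
\<close>

definition gradient :: "('a::real_inner \<Rightarrow> real) \<Rightarrow> 'a \<Rightarrow> 'a" where
  "gradient F x = (THE D. GDERIV F x :> D)"

lemma GDERIV_unique: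
  assumes "GDERIV F x :> D" "GDERIV F x :> D'"
  shows "D = D'"
proof -
  have "(\<lambda>h. inner h D) = (\<lambda>h. inner h D')"
    using assms unfolding gderiv_def by (rule has_derivative_unique)
  then have "inner (D - D') D = inner (D - D') D'"
    by (rule fun_cong)
  then have "inner (D - D') (D - D') = 0"
    by (simp add: inner_diff_right)
  then show ?thesis by simp
qed

lemma gradient_eq:
  assumes "GDERIV F x :> D"
  shows "gradient F x = D"
  unfolding gradient_def using assms GDERIV_unique by blast

definition smooth_with_constant :: "real \<Rightarrow> ('a::real_inner \<Rightarrow> real) \<Rightarrow> bool" where
  "smooth_with_constant L F \<longleftrightarrow>
     (\<forall>x. \<exists>D. GDERIV F x :> D) \<and>
     continuous_on UNIV (gradient F) \<and>
     L-lipschitz_on UNIV (gradient F)"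

definition monotone_operator :: "('a::real_inner \<Rightarrow> 'a) \<Rightarrow> bool" where
  "monotone_operator N \<longleftrightarrow> (\<forall>x y. inner (N x - N y) (x - y) \<ge> 0)"

definition bregman_divergence :: "('a::real_inner \<Rightarrow> real) \<Rightarrow> 'a \<Rightarrow> 'a \<Rightarrow> real" where
  "bregman_divergence F y x = F y - F x - inner (gradient F x) (y - x)"

definition lyapunov :: "('a::real_inner \<Rightarrow> real) \<Rightarrow> 'a \<Rightarrow> 'a \<Rightarrow> 'a \<Rightarrow> real \<Rightarrow> real" where
  "lyapunov F xs x y \<gamma> = bregman_divergence F x xs + \<gamma> / 2 * (norm (y - xs))\<^sup>2"

end

theory Submission
  imports Defs
begin

text \<open>
  Put \<open>D z = bregman_divergence F z xs\<close>. This is a convex, \<open>L\<close>-smooth function of \<open>z\<close>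
  with gradient \<open>G z = gradient F z - gradient F xs\<close>, minimal at \<open>xs\<close> with value \<open>0\<close>, and the
  equation for \<open>xs\<close> turns \<open>gradient F z + N w\<close> into \<open>G z + (N w - N xs)\<close>. So the scheme is
  an accelerated gradient method for \<open>D\<close> with a monotone perturbation vanishing at \<open>xs\<close>.

  For one step, write \<open>g = G xt\<close>. The extrapolated point \<open>xt\<close> and the corrected point
  \<open>x'\<close> satisfy \<open>(1 + \<alpha>) (x' - xt) = \<alpha> (y' - y)\<close>. Expanding the change of
  \<open>\<gamma>/2 * norm (y - xs)^2\<close> produces the linear term \<open>- \<alpha> * inner g (y' - xs)\<close>, a term of
  good sign by monotonicity of \<open>N\<close>, and the gain \<open>- \<gamma>/2 * norm (y' - y)^2\<close>. The descent
  lemma for \<open>D\<close> at \<open>xt\<close> costs \<open>\<alpha> * inner g (y' - y)\<close> plus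
  \<open>L * \<alpha>^2 / (2 * (1 + \<alpha>)) * norm (y' - y)^2\<close>; since \<open>L * \<alpha>^2 = \<gamma>\<close>, the gain absorbs the
  square. What remains, \<open>(1 + \<alpha>) * D xt - \<alpha> * inner g (y - xs) \<le> D x\<close>, is the sum
  of the tangent inequality at \<open>xt\<close> towards \<open>x\<close> and \<open>\<alpha>\<close> times the one towards \<open>xs\<close>.

  For the rate, \<open>\<gamma> (Suc k) = \<gamma> k / (1 + \<alpha> k)\<close>, so the contraction factors telescope to
  \<open>\<gamma> k / \<gamma> 0 = (\<alpha> k / \<alpha> 0)^2\<close>. The reciprocal \<open>1 / \<alpha> k\<close> increases in each step by
  \<open>1 / (sqrt (1 + \<alpha> k) + 1)\<close>, which is at least \<open>1 / (sqrt (1 + \<alpha> 0) + 1)\<close> because \<open>\<alpha>\<close> decreases.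
  Hence \<open>\<alpha> 0 / \<alpha> k\<close> is at least \<open>c\<^sub>0 * k + 1\<close>.
\<close>

section \<open>Tangent and descent inequalities\<close>

lemma GDERIV_gradient:
  assumes "smooth_with_constant L F"
  shows "GDERIV F x :> gradient F x"
  using assms gradient_eq unfolding smooth_with_constant_def by metis

lemma gradient_lipschitz:
  assumes "smooth_with_constant L F"
  shows "norm (gradient F x - gradient F y) \<le> L * norm (x - y)"
  using assms lipschitz_onD[of L UNIV "gradient F" x y]
  unfolding smooth_with_constant_def by (simp add: dist_norm)

lemma GDERIV_along_line:
  assumes "GDERIV F (x + t *\<^sub>R h) :> g"
  shows "((\<lambda>t. F (x + t *\<^sub>R h)) has_real_derivative inner h g) (at t)"
proof -
  have "((\<lambda>t. x + t *\<^sub>R h) has_derivative (\<lambda>s. s *\<^sub>R h)) (at t)"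
    by (auto intro!: derivative_eq_intros)
  from has_derivative_compose[OF this assms[unfolded gderiv_def]]
  show ?thesis
    by (simp add: has_field_derivative_def mult.commute[of _ "inner h g"])
qed

lemma convex_on_along_line:
  fixes F :: "'a::real_vector \<Rightarrow> real"
  assumes "convex_on UNIV F"
  shows "convex_on UNIV (\<lambda>t::real. F (x + t *\<^sub>R h))"
proof (rule convex_onI)
  fix t a b :: real
  assume "0 < t" "t < 1"
  have "x + ((1 - t) *\<^sub>R a + t *\<^sub>R b) *\<^sub>R h = (1 - t) *\<^sub>R (x + a *\<^sub>R h) + t *\<^sub>R (x + b *\<^sub>R h)"
    by (simp add: algebra_simps)
  then show "F (x + ((1 - t) *\<^sub>R a + t *\<^sub>R b) *\<^sub>R h)
      \<le> (1 - t) * F (x + a *\<^sub>R h) + t * F (x + b *\<^sub>R h)"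
    using convex_onD[OF assms, of t] \<open>0 < t\<close> \<open>t < 1\<close> by simp
qed simp

text \<open>Along the segment from \<open>x\<close> to \<open>z\<close> this is the tangent inequality for a convex function of
  one real variable.\<close>

lemma convex_above_tangent:
  assumes "convex_on UNIV F" and "GDERIV F x :> g"
  shows "F x + inner g (z - x) \<le> F z"
proof -
  let ?f = "\<lambda>t. F (x + t *\<^sub>R (z - x))"
  have "(?f has_real_derivative inner (z - x) g) (at 0)"
    using assms(2) by (intro GDERIV_along_line) simp
  then have "inner (z - x) g * (1 - 0) \<le> ?f 1 - ?f 0"
    by (intro convex_on_imp_above_tangent[OF convex_on_along_line[OF assms(1)]]) auto
  then show ?thesis
    by (simp add: inner_commute)
qed

text \<open>The descent lemma. It suffices that the difference of the two sides has the right monotonicity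
  along the segment from \<open>x\<close> to \<open>z\<close>, where the Lipschitz bound on the gradient controls its
  derivative.\<close>

lemma smooth_below_quadratic:
  assumes "smooth_with_constant L F"
  shows "F z \<le> F x + inner (gradient F x) (z - x) + L / 2 * (norm (z - x))\<^sup>2"
proof -
  define h where "h = z - x"
  let ?f = "\<lambda>t. F (x + t *\<^sub>R h) - t * inner h (gradient F x) - L / 2 * t\<^sup>2 * (norm h)\<^sup>2"
  have "?f 1 \<le> ?f 0"
  proof (rule DERIV_nonpos_imp_nonincreasing[where f = ?f])
    fix t :: real
    assume t: "0 \<le> t" "t \<le> 1"
    let ?d = "inner h (gradient F (x + t *\<^sub>R h)) - inner h (gradient F x) - L * t * (norm h)\<^sup>2"
    have "(?f has_real_derivative ?d) (at t)"
      by (rule derivative_eq_intros GDERIV_along_line GDERIV_gradient[OF assms] refl | simp)+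
    moreover have "?d \<le> 0"
    proof -
      have "inner h (gradient F (x + t *\<^sub>R h) - gradient F x)
          \<le> norm h * norm (gradient F (x + t *\<^sub>R h) - gradient F x)"
        by (rule norm_cauchy_schwarz)
      also have "\<dots> \<le> norm h * (L * norm (t *\<^sub>R h))"
        using gradient_lipschitz[OF assms, of "x + t *\<^sub>R h" x]
        by (intro mult_left_mono) auto
      also have "\<dots> = L * t * (norm h)\<^sup>2"
        using t by (simp add: power2_eq_square)
      finally show ?thesis
        by (simp add: inner_diff_right)
    qed
    ultimately show "\<exists>d. (?f has_real_derivative d) (at t) \<and> d \<le> 0"
      by blast
  qed simp
  then show ?thesis
    by (simp add: h_def inner_commute)
qed

section \<open>Contraction of the Lyapunov function\<close>

text \<open>The previous two inequalities for \<open>F\<close> carry over to the divergence from a fixed point \<open>w\<close>, since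
  it differs from \<open>F\<close> by an affine function.\<close>

lemma bregman_above_tangent:
  assumes "convex_on UNIV F" and "smooth_with_constant L F"
  shows "bregman_divergence F x w + inner (gradient F x - gradient F w) (z - x)
    \<le> bregman_divergence F z w"
  using convex_above_tangent[OF assms(1) GDERIV_gradient[OF assms(2)], of x z]
  by (simp add: bregman_divergence_def inner_diff_left inner_diff_right)

lemma bregman_below_quadratic:
  assumes "smooth_with_constant L F"
  shows "bregman_divergence F z w
    \<le> bregman_divergence F x w + inner (gradient F x - gradient F w) (z - x)
       + L / 2 * (norm (z - x))\<^sup>2"
  using smooth_below_quadratic[OF assms, of z x]
  by (simp add: bregman_divergence_def inner_diff_left inner_diff_right)

lemma bregman_self [simp]: "bregman_divergence F w w = 0"
  by (simp add: bregman_divergence_def)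

lemma lyapunov_nonneg:
  assumes "convex_on UNIV F" and "smooth_with_constant L F" and "\<gamma> \<ge> 0"
  shows "0 \<le> lyapunov F w x y \<gamma>"
  using bregman_above_tangent[OF assms(1,2), of w w x] assms(3)
  by (simp add: lyapunov_def)

text \<open>One step of the scheme with all divisions cleared. The condition \<open>L * \<alpha>\<^sup>2 = \<gamma>\<close> is what makes
  the quadratic cost of the descent lemma in the position part no larger than the quadratic gain
  in the velocity part.\<close>

lemma lyapunov_contraction:
  fixes F :: "'a::real_inner \<Rightarrow> real"
  assumes convex: "convex_on UNIV F" and smooth: "smooth_with_constant L F"
    and mono: "monotone_operator N" and zero: "gradient F w + N w = 0"
    and \<alpha>: "\<alpha> > 0" "L * \<alpha>\<^sup>2 = \<gamma>" and \<gamma>: "\<gamma> \<ge> 0" "(1 + \<alpha>) * \<gamma>' = \<gamma>"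
    and xt: "xt - x = \<alpha> *\<^sub>R (y - xt)"
    and y': "\<gamma> *\<^sub>R (y' - y) = - (\<alpha> *\<^sub>R (gradient F xt + N y'))"
    and x': "x' - x = \<alpha> *\<^sub>R (y' - x')"
  shows "(1 + \<alpha>) * lyapunov F w x' y' \<gamma>' \<le> lyapunov F w x y \<gamma>"
proof -
  define g where "g = gradient F xt - gradient F w"
  let ?D = "\<lambda>z. bregman_divergence F z w"

  \<comment> \<open>Polarization of \<open>(norm (y' - w))\<^sup>2 - (norm (y - w))\<^sup>2\<close> around \<open>y'\<close>, the point where the implicit
    scheme evaluates \<open>N\<close>, pairs \<open>N y' - N w\<close> with \<open>y' - w\<close>, as monotonicity requires.\<close>
  have velocity: "\<gamma> / 2 * (norm (y' - w))\<^sup>2 - \<gamma> / 2 * (norm (y - w))\<^sup>2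
      \<le> - \<alpha> * inner g (y' - w) - \<gamma> / 2 * (norm (y' - y))\<^sup>2"
  proof -
    have "\<gamma> * inner (y' - y) (y' - w) = inner (\<gamma> *\<^sub>R (y' - y)) (y' - w)"
      by simp
    also have "\<dots> = - (\<alpha> * inner (g + (N y' - N w)) (y' - w))"
    proof -
      have "gradient F xt + N y' = g + (N y' - N w)"
        using zero by (simp add: g_def algebra_simps add_eq_0_iff)
      then show ?thesis
        by (simp only: y' inner_minus_left inner_scaleR_left)
    qed
    also have "\<dots> \<le> - \<alpha> * inner g (y' - w)"
    proof -
      have "0 \<le> \<alpha> * inner (N y' - N w) (y' - w)"
        using mono \<alpha>(1) by (simp add: monotone_operator_def)
      then show ?thesis
        by (simp add: inner_add_left distrib_left)
    qed
    finally have "\<gamma> * inner (y' - y) (y' - w) \<le> - \<alpha> * inner g (y' - w)" .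
    moreover have "\<gamma> / 2 * (norm (y' - w))\<^sup>2 - \<gamma> / 2 * (norm (y - w))\<^sup>2
        = \<gamma> * inner (y' - y) (y' - w) - \<gamma> / 2 * (norm (y' - y))\<^sup>2"
      by (simp add: power2_norm_eq_inner inner_diff_left inner_diff_right inner_commute
          field_simps)
    ultimately show ?thesis
      by simp
  qed

  have position: "(1 + \<alpha>) * ?D x'
      \<le> (1 + \<alpha>) * ?D xt + \<alpha> * inner g (y' - y) + \<gamma> / 2 * (norm (y' - y))\<^sup>2"
  proof -
    define \<beta> where "\<beta> = \<alpha> / (1 + \<alpha>)"
    have \<beta>: "(1 + \<alpha>) * \<beta> = \<alpha>" "0 \<le> \<beta>" "\<beta> \<le> \<alpha>"
      using \<alpha>(1) by (auto simp: \<beta>_def field_simps)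
    have "(1 + \<alpha>) *\<^sub>R (x' - xt) = \<alpha> *\<^sub>R (y' - y)"
      using xt x' by (simp add: algebra_simps)
    then have "(1 + \<alpha>) *\<^sub>R (x' - xt) = (1 + \<alpha>) *\<^sub>R \<beta> *\<^sub>R (y' - y)"
      by (simp only: scaleR_scaleR \<beta>(1))
    then have diff: "x' - xt = \<beta> *\<^sub>R (y' - y)"
      using \<alpha>(1) by (subst (asm) scaleR_cancel_left) auto
    have "?D x' \<le> ?D xt + \<beta> * inner g (y' - y) + L / 2 * (\<beta> * norm (y' - y))\<^sup>2"
      using bregman_below_quadratic[OF smooth, of x' w xt] \<beta>(2) by (simp add: diff g_def)
    then have "(1 + \<alpha>) * ?D x' \<le> (1 + \<alpha>) * (?D xt + \<beta> * inner g (y' - y)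
        + L / 2 * (\<beta> * norm (y' - y))\<^sup>2)"
      using \<alpha>(1) by (intro mult_left_mono) auto
    also have "\<dots> = (1 + \<alpha>) * ?D xt + ((1 + \<alpha>) * \<beta>) * inner g (y' - y)
        + ((1 + \<alpha>) * \<beta>) * \<beta> * L / 2 * (norm (y' - y))\<^sup>2"
      by (simp add: algebra_simps power2_eq_square add_divide_distrib)
    also have "\<dots> \<le> (1 + \<alpha>) * ?D xt + \<alpha> * inner g (y' - y) + \<gamma> / 2 * (norm (y' - y))\<^sup>2"
    proof -
      have "0 \<le> L"
        using \<alpha> \<gamma>(1) by (metis zero_le_mult_iff zero_less_power not_le)
      then have "\<alpha> * \<beta> * L \<le> \<alpha> * \<alpha> * L"
        using \<alpha>(1) \<beta>(3) by (intro mult_right_mono mult_left_mono) auto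
      also have "\<dots> = \<gamma>"
        using \<alpha>(2) by (simp add: power2_eq_square algebra_simps)
      finally show ?thesis
        unfolding \<beta>(1) by (intro add_left_mono mult_right_mono) auto
    qed
    finally show ?thesis .
  qed

  \<comment> \<open>Tangents at \<open>xt\<close>: towards \<open>x\<close> with weight \<open>1\<close>, and towards \<open>w\<close>, where the divergence
    vanishes, with weight \<open>\<alpha>\<close>. The multiples of \<open>inner g xt\<close> cancel.\<close>
  have tangents: "(1 + \<alpha>) * ?D xt - \<alpha> * inner g (y - w) \<le> ?D x"
  proof -
    have "x - xt = - (\<alpha> *\<^sub>R (y - xt))"
      using xt by (simp add: algebra_simps)
    then have "?D xt - \<alpha> * inner g (y - xt) \<le> ?D x"
      using bregman_above_tangent[OF convex smooth, of xt w x] by (simp add: g_def)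
    moreover have "\<alpha> * (?D xt + inner g (w - xt)) \<le> 0"
      using bregman_above_tangent[OF convex smooth, of xt w w] \<alpha>(1)
      by (simp add: g_def mult_le_0_iff)
    ultimately show ?thesis
      by (simp add: inner_diff_right algebra_simps)
  qed

  have left: "(1 + \<alpha>) * lyapunov F w x' y' \<gamma>' = (1 + \<alpha>) * ?D x' + \<gamma> / 2 * (norm (y' - w))\<^sup>2"
    unfolding lyapunov_def \<gamma>(2)[symmetric] by (simp add: algebra_simps)
  show ?thesis
    unfolding left using velocity position tangents
    by (simp add: lyapunov_def inner_diff_right algebra_simps)
qed

section \<open>Decay of the step sizes\<close>

text \<open>Since \<open>\<alpha> (Suc k) = \<alpha> k / sqrt (1 + \<alpha> k)\<close>, the reciprocal grows by
  \<open>(sqrt (1 + \<alpha> k) - 1) / \<alpha> k = 1 / (sqrt (1 + \<alpha> k) + 1)\<close>. As \<open>\<alpha>\<close> decreases, this increment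
  is smallest in the first step, and \<open>k\<close> times that smallest increment gives the bound.\<close>

lemma step_size_decay:
  fixes \<alpha> :: "nat \<Rightarrow> real"
  assumes pos: "\<And>k. \<alpha> k > 0" and step: "\<And>k. (1 + \<alpha> k) * (\<alpha> (Suc k))\<^sup>2 = (\<alpha> k)\<^sup>2"
  shows "\<alpha> 0 / (sqrt (\<alpha> 0 + 1) + 1) * real k + 1 \<le> \<alpha> 0 / \<alpha> k"
proof -
  have root: "sqrt (1 + \<alpha> k) * \<alpha> (Suc k) = \<alpha> k" for k
    using arg_cong[OF step[of k], of sqrt] pos[of k] pos[of "Suc k"]
    by (simp add: real_sqrt_mult)
  have "\<alpha> (Suc k) \<le> \<alpha> k" for k
  proof -
    have "1 * \<alpha> (Suc k) \<le> sqrt (1 + \<alpha> k) * \<alpha> (Suc k)"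
      using pos[of k] pos[of "Suc k"] by (intro mult_right_mono) auto
    then show ?thesis
      by (simp add: root)
  qed
  then have decreasing: "\<alpha> k \<le> \<alpha> 0" for k
    by (induction k) (auto intro: order_trans)
  have increment: "1 / (sqrt (\<alpha> 0 + 1) + 1) \<le> 1 / \<alpha> (Suc k) - 1 / \<alpha> k" for k
  proof -
    define r where "r = sqrt (1 + \<alpha> k)"
    have r: "r > 1" "r\<^sup>2 = 1 + \<alpha> k"
      using pos[of k] by (auto simp: r_def)
    have "1 / (sqrt (\<alpha> 0 + 1) + 1) \<le> 1 / (r + 1)"
      using decreasing[of k] r(1) by (intro divide_left_mono add_right_mono)
        (auto simp: r_def intro!: mult_pos_pos add_pos_pos)
    also have "\<dots> = (r - 1) / \<alpha> k"
      using r pos[of k] by (simp add: field_simps power2_eq_square)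
    also have "\<dots> = 1 / \<alpha> (Suc k) - 1 / \<alpha> k"
    proof -
      have "r / \<alpha> k = 1 / \<alpha> (Suc k)"
        using root[of k] r(1) pos[of k] pos[of "Suc k"] by (simp add: r_def field_simps)
      then show ?thesis
        by (simp add: diff_divide_distrib)
    qed
    finally show ?thesis .
  qed
  have "1 / \<alpha> 0 + real k * (1 / (sqrt (\<alpha> 0 + 1) + 1)) \<le> 1 / \<alpha> k"
  proof (induction k)
    case (Suc k)
    then show ?case
      using increment[of k] by (simp add: algebra_simps add_divide_distrib)
  qed simp
  then have "\<alpha> 0 * (1 / \<alpha> 0 + real k * (1 / (sqrt (\<alpha> 0 + 1) + 1))) \<le> \<alpha> 0 * (1 / \<alpha> k)"
    using pos[of 0] by (intro mult_left_mono) auto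
  then show ?thesis
    using pos[of 0] by (simp add: algebra_simps)
qed

section \<open>Convergence of the scheme\<close>

theorem theorem8p2:
  fixes F :: "'v::{real_inner, complete_space} \<Rightarrow> real"
    and N :: "'v \<Rightarrow> 'v"
    and L :: real
    and xs :: 'v
    and x xt y :: "nat \<Rightarrow> 'v"
    and \<gamma> \<alpha> :: "nat \<Rightarrow> real"
  assumes "L > 0"
    and "convex_on UNIV F"
    and "smooth_with_constant L F"
    and "monotone_operator N"
    and "gradient F xs + N xs = 0"
    and "\<gamma> 0 > 0"
    and "\<And>k. \<alpha> k = sqrt (\<gamma> k / L)"
    and "\<And>k. (xt (Suc k) - x k) /\<^sub>R \<alpha> k = y k - xt (Suc k)"
    and "\<And>k. (y (Suc k) - y k) /\<^sub>R \<alpha> k =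
               - ((1 / \<gamma> k) *\<^sub>R (gradient F (xt (Suc k)) + N (y (Suc k))))"
    and "\<And>k. (x (Suc k) - x k) /\<^sub>R \<alpha> k = y (Suc k) - x (Suc k)"
    and "\<And>k. (\<gamma> (Suc k) - \<gamma> k) / \<alpha> k = - \<gamma> (Suc k)"
  shows "(\<forall>k. lyapunov F xs (x (Suc k)) (y (Suc k)) (\<gamma> (Suc k))
              \<le> 1 / (1 + \<alpha> k) * lyapunov F xs (x k) (y k) (\<gamma> k)) \<and>
         (let c\<^sub>0 = sqrt (\<gamma> 0 / L) / (sqrt (sqrt (\<gamma> 0 / L) + 1) + 1)
          in \<forall>k. lyapunov F xs (x k) (y k) (\<gamma> k)
                 \<le> 1 / (c\<^sub>0 * real k + 1)\<^sup>2 * lyapunov F xs (x 0) (y 0) (\<gamma> 0))"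
proof -
  let ?E = "\<lambda>k. lyapunov F xs (x k) (y k) (\<gamma> k)"

  \<comment> \<open>If \<open>\<gamma> k > 0\<close> then \<open>\<alpha> k > 0\<close>, so that the quotients in the scheme are genuine.\<close>
  have \<gamma>_step: "(1 + \<alpha> k) * \<gamma> (Suc k) = \<gamma> k" if "\<gamma> k > 0" for k
  proof -
    have "\<alpha> k > 0"
      using that assms(1,7) by simp
    then show ?thesis
      using assms(11)[of k] by (simp add: field_simps)
  qed
  have \<gamma>_pos: "\<gamma> k > 0" for k
  proof (induction k)
    case (Suc k)
    moreover have "1 + \<alpha> k > 0"
      using Suc assms(1,7) by (simp add: add_pos_nonneg)
    ultimately show ?case
      using \<gamma>_step[of k] by (metis zero_less_mult_pos)
  qed (rule assms(6))
  have \<alpha>_pos: "\<alpha> k > 0" for k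
    using \<gamma>_pos assms(1,7) by simp
  have \<alpha>_sq: "L * (\<alpha> k)\<^sup>2 = \<gamma> k" for k
    using \<gamma>_pos[of k] assms(1,7) by simp

  have contraction: "(1 + \<alpha> k) * ?E (Suc k) \<le> ?E k" for k
  proof (rule lyapunov_contraction[OF assms(2,3,4,5) \<alpha>_pos \<alpha>_sq less_imp_le[OF \<gamma>_pos]
        \<gamma>_step[OF \<gamma>_pos]])
    have cancel: "u = \<alpha> k *\<^sub>R v" if "u /\<^sub>R \<alpha> k = v" for u v :: 'v
      using that \<alpha>_pos[of k] by auto
    show "xt (Suc k) - x k = \<alpha> k *\<^sub>R (y k - xt (Suc k))"
      by (rule cancel[OF assms(8)])
    show "x (Suc k) - x k = \<alpha> k *\<^sub>R (y (Suc k) - x (Suc k))"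
      by (rule cancel[OF assms(10)])
    show "\<gamma> k *\<^sub>R (y (Suc k) - y k) = - (\<alpha> k *\<^sub>R (gradient F (xt (Suc k)) + N (y (Suc k))))"
      unfolding cancel[OF assms(9)] using \<gamma>_pos[of k] by simp
  qed

  have telescoped: "?E k \<le> \<gamma> k / \<gamma> 0 * ?E 0" for k
  proof (induction k)
    case 0
    then show ?case
      using assms(6) by simp
  next
    case (Suc k)
    have "(1 + \<alpha> k) * ?E (Suc k) \<le> \<gamma> k / \<gamma> 0 * ?E 0"
      using contraction[of k] Suc by linarith
    also have "\<dots> = (1 + \<alpha> k) * (\<gamma> (Suc k) / \<gamma> 0 * ?E 0)"
      by (simp flip: \<gamma>_step[OF \<gamma>_pos[of k]])
    finally show ?case
      using \<alpha>_pos[of k] by (simp only: mult_le_cancel_left_pos add_pos_pos zero_less_one)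
  qed

  define c where "c = \<alpha> 0 / (sqrt (\<alpha> 0 + 1) + 1)"
  have "?E k \<le> 1 / (c * real k + 1)\<^sup>2 * ?E 0" for k
  proof -
    have "(1 + \<alpha> k) * (\<alpha> (Suc k))\<^sup>2 = (\<alpha> k)\<^sup>2" for k
    proof -
      have "L * ((1 + \<alpha> k) * (\<alpha> (Suc k))\<^sup>2) = L * (\<alpha> k)\<^sup>2"
        using \<gamma>_step[OF \<gamma>_pos[of k]] \<alpha>_sq[of k] \<alpha>_sq[of "Suc k"] by (metis mult.left_commute)
      then show ?thesis
        using assms(1) by simp
    qed
    then have le: "c * real k + 1 \<le> \<alpha> 0 / \<alpha> k"
      unfolding c_def by (rule step_size_decay[OF \<alpha>_pos])
    have "0 \<le> c"
      using \<alpha>_pos[of 0] by (simp add: c_def)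
    then have pos: "0 < c * real k + 1"
      by (simp add: add_nonneg_pos)
    have "\<gamma> k / \<gamma> 0 = 1 / (\<alpha> 0 / \<alpha> k)\<^sup>2"
      using assms(1) by (simp flip: \<alpha>_sq add: power_divide)
    also have "\<dots> \<le> 1 / (c * real k + 1)\<^sup>2"
      using le pos by (intro divide_left_mono power_mono mult_pos_pos zero_less_power) auto
    finally have "\<gamma> k / \<gamma> 0 * ?E 0 \<le> 1 / (c * real k + 1)\<^sup>2 * ?E 0"
      using lyapunov_nonneg[OF assms(2,3)] assms(6) by (intro mult_right_mono) auto
    with telescoped[of k] show ?thesis
      by linarith
  qed
  moreover have "?E (Suc k) \<le> 1 / (1 + \<alpha> k) * ?E k" for k
    using contraction[of k] \<alpha>_pos[of k] by (simp add: field_simps)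
  ultimately show ?thesis
    by (simp only: Let_def c_def assms(7)) blast
qed

end
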